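(* For all $m\ge1$ and $1\le k\le 2m-1$, $\tilde L_{2m-1,k}=K_{2m-1,k}$. In particular $\mathrm{per}(\tilde L_{2m-1})=(-1)^mG_{2m}$, and for every positive integer $n$, $\mathrm{per}\left[\left\lfloor\frac{2j-k}{n}\right\rfloor\right]_{1\le j,k\le n}=2(2^{n+1}-1)B_{n+1}$.
   Context: $\mathrm{per}[a_{i,j}]_{1\le i,j\le N}=\sum_{\pi\in\mathfrak S_N}\prod_i a_{i,\pi(i)}$. For $m\ge1$, $\tilde L_{2m-1}=[\ell_{i,j}]_{1\le i,j\le 2m-1}$ is the 0/1 matrix with $\ell_{i,j}=1$ if ($1\le i\le m-1$ and $2i\le j\le 2m-1$), or ($m\le i\le 2m-2$ and $1\le j\le 2(i-m)+2$), or $i=2m-1$; and $0$ otherwise. $\tilde L_{2m-1,i}$ is the permanent of the submatrix of $\tilde L_{2m-1}$ obtained by deleting row $2m-1$ and column $i$. Let $\mathcal D_{2m+1}$ be the set of permutations $\sigma\in\mathfrak S_{2m+1}$ such that for all $i\in[2m]$, $\sigma(i)>\sigma(i+1)$ if and only if $\sigma(i)$ is even; and $K_{2m-1,k}=\#\{\sigma\in\mathcal D_{2m+1}:\sigma(1)=k+1\}$ (Kreweras' triangle). Genocchi numbers: $\frac{2x}{e^x+1}=\sum_{n\ge1}G_n\frac{x^n}{n!}$. Bernoulli numbers: $\frac{x}{e^x-1}=\sum_{n\ge0}B_n\frac{x^n}{n!}$. $\lfloor\cdot\rfloor$ is the floor function.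
   Formalization: The clause per(L̃_{2m-1}) = (-1)^m G_{2m} is false as printed (for m = 2 the permanent is 3, but G_4 = 1); it is replaced by per(L̃_{2m-1}) = (-1)^{m+1} G_{2m+2} for all m ≥ 1. *)

theory Defs
  imports
    "Jordan_Normal_Form.Determinant"
    "HOL-Computational_Algebra.Formal_Power_Series"
    Complex_Main
begin

definition permanent :: "'a :: comm_semiring_1 mat \<Rightarrow> 'a" where
  "permanent A =
     (\<Sum>\<pi> \<in> {\<pi>. \<pi> permutes {0..<dim_row A}}. \<Prod>i = 0..<dim_row A. A $$ (i, \<pi> i))"

(* Matrices from Jordan_Normal_Form are indexed from 0, the entries a i j below from 1. *)
definition mat_of_entries :: "nat \<Rightarrow> (nat \<Rightarrow> nat \<Rightarrow> 'a) \<Rightarrow> 'a mat" where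
  "mat_of_entries N a = mat N N (\<lambda>(i, j). a (i + 1) (j + 1))"

definition Lt_entry :: "nat \<Rightarrow> nat \<Rightarrow> nat \<Rightarrow> int" where
  "Lt_entry m i j =
     (if (1 \<le> i \<and> i \<le> m - 1 \<and> 2 * i \<le> j \<and> j \<le> 2 * m - 1)
       \<or> (m \<le> i \<and> i \<le> 2 * m - 2 \<and> 1 \<le> j \<and> j \<le> 2 * (i - m) + 2)
       \<or> i = 2 * m - 1
      then 1 else 0)"

(* Lt_mat m and Lt_minor m k are the objects with subscripts 2m-1 and 2m-1,k, for m \<ge> 1. *)
definition Lt_mat :: "nat \<Rightarrow> int mat" where
  "Lt_mat m = mat_of_entries (2 * m - 1) (Lt_entry m)"

(* Row 2m-1 and column k, counted from 1, have the 0-based indices 2m-2 and k-1. *)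
definition Lt_minor :: "nat \<Rightarrow> nat \<Rightarrow> int" where
  "Lt_minor m k = permanent (mat_delete (Lt_mat m) (2 * m - 2) (k - 1))"

(* The set of permutations of {1..2m+1} in which, before the last position,
   the descent tops are exactly the even values. *)
definition Kreweras_perms :: "nat \<Rightarrow> (nat \<Rightarrow> nat) set" where
  "Kreweras_perms m =
     {\<sigma>. \<sigma> permutes {1..2 * m + 1} \<and>
         (\<forall>i \<in> {1..2 * m}. \<sigma> i > \<sigma> (i + 1) \<longleftrightarrow> even (\<sigma> i))}"

(* The entry of Kreweras' triangle with subscript 2m-1,k. *)
definition Kreweras :: "nat \<Rightarrow> nat \<Rightarrow> nat" where
  "Kreweras m k = card {\<sigma> \<in> Kreweras_perms m. \<sigma> 1 = k + 1}"

(* Signed Genocchi numbers, with exponential generating function 2x / (e^x + 1):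
   G_1 = 1, G_2 = -1, G_4 = 1, G_6 = -3, G_8 = 17.  With this indexing the permanents of
   Lt_mat 1, Lt_mat 2, Lt_mat 3, which are 1, 3, 17, equal (-1)^(m+1) G_(2m+2). *)
definition genocchi :: "nat \<Rightarrow> rat" where
  "genocchi n = fact n * fps_nth (2 * fps_X / (fps_exp 1 + 1)) n"

(* Exponential generating function x / (e^x - 1); the quotient is exact although
   the denominator has no constant term. *)
definition bernoulli :: "nat \<Rightarrow> rat" where
  "bernoulli n = fact n * fps_nth (fps_X / (fps_exp 1 - 1)) n"

end

theory Submission
  imports Defs
begin

text \<open>
  The descent condition says that an odd letter is followed by a larger and an even letter by a
  smaller one. Allowing an odd letter to be mapped to itself gives the bipartite graph behind all
  the permanents, and Foata's transformation matches words with permutations; here both sides are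
  shown to obey the same recursion, Laplace expansion along the row of the current letter.
  Let \<open>w m n\<close> be the number of injections from \<open>{1..2m}\<close> to \<open>{1..2m+n}\<close> in this graph. Expanding along the
  last two rows gives
  \<open>w (m + 1) n = (n + 1) * ((n + 2) * w m (n + 1) - (n + 1) * w m n)\<close>.
  If \<open>L\<close> is the linear functional on polynomials that maps \<open>s ^ i\<close> to the Genocchi number \<open>G i\<close>, then
  \<open>(n + 1) * w m n = L ((-s\<^sup>2) ^ (m + 1) * (\<Prod>j\<le>n. 1 - s\<^sup>2 / j\<^sup>2))\<close> satisfies this recursion, and the case
  \<open>m = 0\<close> follows from \<open>L (p (s + 1)) + L (p s) = 2 * p' 0\<close>.
\<close>

section \<open>Injections in a bipartite graph and permanents\<close>

text \<open>For finite \<open>R\<close> and \<open>C\<close> of equal size this is the permanent of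
  a 0/1 matrix. The rectangular case is what makes the later recursion close;
  \<open>\<rightarrow>\<^sub>E\<close> fixes values off \<open>R\<close>, so each injection counts
  once.\<close>

definition inj_count :: "('a \<Rightarrow> 'b \<Rightarrow> bool) \<Rightarrow> 'a set \<Rightarrow> 'b set \<Rightarrow> nat" where
  "inj_count P R C = card {f \<in> R \<rightarrow>\<^sub>E C. inj_on f R \<and> (\<forall>v\<in>R. P v (f v))}"

lemma finite_inj_set:
  assumes "finite R" "finite C"
  shows "finite {f \<in> R \<rightarrow>\<^sub>E C. inj_on f R \<and> (\<forall>v\<in>R. P v (f v))}"
  using finite_PiE[of R "\<lambda>_. C"] assms by simp

lemma inj_count_empty [simp]: "inj_count P {} C = 1"
  by (simp add: inj_count_def)

text \<open>Laplace expansion along the row \<open>p\<close>: choose its column \<open>x\<close>,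
  then match the remaining rows without \<open>x\<close>.\<close>

lemma inj_count_insert:
  assumes "finite R" "finite C" "p \<notin> R"
  shows "inj_count P (insert p R) C = (\<Sum>x\<in>{x\<in>C. P p x}. inj_count P R (C - {x}))"
proof -
  define F where "F R C = {f \<in> R \<rightarrow>\<^sub>E C. inj_on f R \<and> (\<forall>v\<in>R. P v (f v))}" for R C
  define A where "A = (SIGMA x:{x\<in>C. P p x}. F R (C - {x}))"
  have "bij_betw (\<lambda>(x, f). f(p := x)) A (F (insert p R) C)"
  \<comment> \<open>The inverse reads off the value at \<open>p\<close> and resets it to undefined
    by restriction.\<close>
  proof (rule bij_betw_byWitness[where f' = "\<lambda>f. (f p, restrict f R)"])
    show "\<forall>a\<in>A. (\<lambda>f. (f p, restrict f R)) (case a of (x, f) \<Rightarrow> f(p := x)) = a"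
      using assms(3) by (auto simp: A_def F_def PiE_def extensional_def fun_eq_iff restrict_def)
    show "\<forall>f\<in>F (insert p R) C. (case (f p, restrict f R) of (x, f) \<Rightarrow> f(p := x)) = f"
      by (auto simp: F_def PiE_def extensional_def fun_eq_iff restrict_def)
    show "(\<lambda>(x, f). f(p := x)) ` A \<subseteq> F (insert p R) C"
    proof (clarsimp simp: A_def)
      fix x f assume x: "x \<in> C" "P p x" and f: "f \<in> F R (C - {x})"
      have "inj_on (f(p := x)) (insert p R)"
        using f assms(3) by (auto simp: F_def inj_on_def PiE_iff)
      then show "f(p := x) \<in> F (insert p R) C"
        using f x assms(3) by (auto simp: F_def PiE_iff extensional_def)
    qed
    show "(\<lambda>f. (f p, restrict f R)) ` F (insert p R) C \<subseteq> A"
      using assms(3) by (auto simp: A_def F_def PiE_iff inj_on_def)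
  qed
  then have "card (F (insert p R) C) = card A"
    by (simp add: bij_betw_same_card)
  also have "\<dots> = (\<Sum>x\<in>{x\<in>C. P p x}. card (F R (C - {x})))"
    unfolding A_def using assms finite_inj_set[of R]
    by (subst card_SigmaI) (auto simp: F_def)
  finally show ?thesis
    by (simp add: inj_count_def F_def)
qed

lemma inj_count_cong:
  assumes "\<And>v w. v \<in> R \<Longrightarrow> w \<in> C \<Longrightarrow> P v w = Q v w"
  shows "inj_count P R C = inj_count Q R C"
proof -
  have "{f \<in> R \<rightarrow>\<^sub>E C. inj_on f R \<and> (\<forall>v\<in>R. P v (f v))} =
        {f \<in> R \<rightarrow>\<^sub>E C. inj_on f R \<and> (\<forall>v\<in>R. Q v (f v))}"
    using assms by (auto simp: PiE_iff)
  then show ?thesis by (simp add: inj_count_def)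
qed

text \<open>Transport of \<open>f\<close> to \<open>h \<circ> f \<circ> g\<inverse>\<close>. This
  carries matrix indices starting at 0 over to letters.\<close>

lemma inj_count_reindex:
  assumes g: "bij_betw g R R'" and h: "bij_betw h C C'"
    and PQ: "\<And>v w. v \<in> R \<Longrightarrow> w \<in> C \<Longrightarrow> P v w = Q (g v) (h w)"
  shows "inj_count P R C = inj_count Q R' C'"
proof -
  define g' where "g' = inv_into R g"
  define h' where "h' = inv_into C h"
  have g': "g' b \<in> R" "g (g' b) = b" if "b \<in> R'" for b
    using g that by (auto simp: g'_def bij_betw_def inv_into_into f_inv_into_f)
  have h': "h' b \<in> C" "h (h' b) = b" if "b \<in> C'" for b
    using h that by (auto simp: h'_def bij_betw_def inv_into_into f_inv_into_f)
  have gi: "g a \<in> R'" "g' (g a) = a" if "a \<in> R" for a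
    using g that by (auto simp: g'_def bij_betw_def)
  have hi: "h a \<in> C'" "h' (h a) = a" if "a \<in> C" for a
    using h that by (auto simp: h'_def bij_betw_def)
  have "bij_betw (\<lambda>f. restrict (\<lambda>b. h (f (g' b))) R')
     {f \<in> R \<rightarrow>\<^sub>E C. inj_on f R \<and> (\<forall>v\<in>R. P v (f v))}
     {f \<in> R' \<rightarrow>\<^sub>E C'. inj_on f R' \<and> (\<forall>v\<in>R'. Q v (f v))}"
  proof (rule bij_betw_byWitness[where f' = "\<lambda>f. restrict (\<lambda>a. h' (f (g a))) R"], goal_cases)
    case 1 show ?case using gi hi g' h'
      by (auto simp: PiE_iff fun_eq_iff restrict_def extensional_def)
  next
    case 2 show ?case using gi hi g' h'
      by (auto simp: PiE_iff fun_eq_iff restrict_def extensional_def)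
  next
    case 3 show ?case
    proof (clarify, intro conjI)
      fix f assume f: "f \<in> R \<rightarrow>\<^sub>E C" "inj_on f R" "\<forall>v\<in>R. P v (f v)"
      show "restrict (\<lambda>b. h (f (g' b))) R' \<in> R' \<rightarrow>\<^sub>E C'"
        using f g' hi by (auto simp: PiE_iff)
      show "inj_on (restrict (\<lambda>b. h (f (g' b))) R') R'"
      proof (rule inj_onI, simp)
        fix x y assume xy: "x \<in> R'" "y \<in> R'" "h (f (g' x)) = h (f (g' y))"
        have "f (g' x) = f (g' y)" using hi(2) xy f(1) g'(1) by (metis PiE_mem)
        then have "g' x = g' y" using f(2) g'(1) xy by (auto simp: inj_on_def)
        then show "x = y" using g'(2) xy by metis
      qed
      show "\<forall>v\<in>R'. Q v (restrict (\<lambda>b. h (f (g' b))) R' v)"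
        using f PQ g' by (fastforce simp: PiE_iff)
    qed
  next
    case 4 show ?case
    proof (clarify, intro conjI)
      fix f assume f: "f \<in> R' \<rightarrow>\<^sub>E C'" "inj_on f R'" "\<forall>v\<in>R'. Q v (f v)"
      show "restrict (\<lambda>a. h' (f (g a))) R \<in> R \<rightarrow>\<^sub>E C"
        using f gi h' by (auto simp: PiE_iff)
      show "inj_on (restrict (\<lambda>a. h' (f (g a))) R) R"
      proof (rule inj_onI, simp)
        fix x y assume xy: "x \<in> R" "y \<in> R" "h' (f (g x)) = h' (f (g y))"
        have "f (g x) = f (g y)" using h'(2) xy f(1) gi(1) by (metis PiE_mem)
        then have "g x = g y" using f(2) gi(1) xy by (auto simp: inj_on_def)
        then show "x = y" using gi(2) xy by metis
      qed
      show "\<forall>v\<in>R. P v (restrict (\<lambda>a. h' (f (g a))) R v)"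
      proof (clarsimp)
        fix v assume v: "v \<in> R"
        have "f (g v) \<in> C'" using f gi v by auto
        then show "P v (h' (f (g v)))" using PQ[OF v] h' f(3) gi v by auto
      qed
    qed
  qed
  then show ?thesis
    by (simp add: inj_count_def bij_betw_same_card)
qed

text \<open>Double counting of pairs of an injection and a column missed by it: every injection
  misses \<open>card C - card R\<close> columns.\<close>

lemma sum_inj_count_delete:
  assumes "finite R" "finite C"
  shows "(\<Sum>x\<in>C. inj_count P R (C - {x})) = (card C - card R) * inj_count P R C"
proof -
  define F where "F C = {f \<in> R \<rightarrow>\<^sub>E C. inj_on f R \<and> (\<forall>v\<in>R. P v (f v))}" for C
  have fin: "finite (F C)" if "finite C" for C
    using finite_inj_set[OF assms(1) that] by (simp add: F_def)
  have "(\<Sum>x\<in>C. card (F (C - {x}))) = card (SIGMA x:C. F (C - {x}))"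
    using assms fin by (simp add: card_SigmaI)
  also have "\<dots> = card (SIGMA f:F C. C - f ` R)"
    by (rule bij_betw_same_card[of prod.swap], rule bij_betw_byWitness[where f' = prod.swap])
      (auto simp: F_def PiE_iff)
  also have "\<dots> = (\<Sum>f\<in>F C. card (C - f ` R))"
    using assms fin by (subst card_SigmaI) auto
  also have "\<dots> = (\<Sum>f\<in>F C. card C - card R)"
  proof (rule sum.cong[OF refl])
    fix f assume "f \<in> F C"
    then have "f ` R \<subseteq> C" "inj_on f R" by (auto simp: F_def)
    then show "card (C - f ` R) = card C - card R"
      using assms by (simp add: card_Diff_subset finite_subset card_image)
  qed
  finally show ?thesis by (simp add: inj_count_def F_def)
qed

text \<open>A factor that depends on the row alone comes out of every product. The
  \<open>s i\<close> will be the signs of the rows of the floor matrix.\<close>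

lemma permanent_eq_inj_count:
  fixes s :: "nat \<Rightarrow> 'a :: comm_ring_1"
  assumes "A \<in> carrier_mat N N"
    and A: "\<And>i j. i < N \<Longrightarrow> j < N \<Longrightarrow> A $$ (i, j) = s i * of_bool (P i j)"
  shows "permanent A = (\<Prod>i<N. s i) * of_nat (inj_count P {0..<N} {0..<N})"
proof -
  let ?S = "{\<pi>. \<pi> permutes {0..<N}}"
  let ?G = "{\<pi> \<in> ?S. \<forall>i<N. P i (\<pi> i)}"
  have fin: "finite ?S" by (simp add: finite_permutations)
  have "permanent A = (\<Sum>\<pi>\<in>?S. \<Prod>i = 0..<N. s i * of_bool (P i (\<pi> i)))"
    unfolding permanent_def using assms
    by (auto intro!: sum.cong prod.cong dest: permutes_in_image)
  also have "\<dots> = (\<Sum>\<pi>\<in>?S. if \<forall>i<N. P i (\<pi> i) then (\<Prod>i<N. s i) else 0)"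
  proof (rule sum.cong[OF refl])
    fix \<pi>
    have "(\<Prod>i = 0..<N. of_bool (P i (\<pi> i)) :: 'a) = of_bool (\<forall>i<N. P i (\<pi> i))"
      by (auto simp: of_bool_def intro!: prod_zero)
    then show "(\<Prod>i = 0..<N. s i * of_bool (P i (\<pi> i))) =
        (if \<forall>i<N. P i (\<pi> i) then (\<Prod>i<N. s i) else 0)"
      by (auto simp: prod.distrib atLeast0LessThan)
  qed
  also have "\<dots> = (\<Prod>i<N. s i) * of_nat (card ?G)"
    using fin by (subst sum.inter_filter[symmetric]) (auto simp: mult.commute)
  also have "card ?G = inj_count P {0..<N} {0..<N}"
    unfolding inj_count_def
  \<comment> \<open>Off the index set a permutation is the identity and an extensional function is
    undefined; the two maps exchange these defaults.\<close>
  proof (rule bij_betw_same_card[of "\<lambda>\<pi>. restrict \<pi> {0..<N}"],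
      rule bij_betw_byWitness[where f' = "\<lambda>f i. if i < N then f i else i"], goal_cases)
    case 1 show ?case by (auto simp: permutes_def fun_eq_iff)
  next
    case 2 show ?case by (auto simp: PiE_iff extensional_def fun_eq_iff)
  next
    case 3 show ?case
    proof (clarify, intro conjI)
      fix \<pi> assume p: "\<pi> permutes {0..<N}" "\<forall>i<N. P i (\<pi> i)"
      show "restrict \<pi> {0..<N} \<in> {0..<N} \<rightarrow>\<^sub>E {0..<N}"
        using permutes_in_image[OF p(1)] by auto
      show "inj_on (restrict \<pi> {0..<N}) {0..<N}"
        using permutes_inj_on[OF p(1)] by (simp add: inj_on_restrict_eq)
      show "\<forall>v\<in>{0..<N}. P v (restrict \<pi> {0..<N} v)" using p by simp
    qed
  next
    case 4 show ?case
    proof (clarify, intro conjI)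
      fix f assume f: "f \<in> {0..<N} \<rightarrow>\<^sub>E {0..<N}" "inj_on f {0..<N}" "\<forall>v\<in>{0..<N}. P v (f v)"
      have inj: "inj_on (\<lambda>i. if i < N then f i else i) {0..<N}"
        using f(2) by (simp add: inj_on_def)
      have "(\<lambda>i. if i < N then f i else i) ` {0..<N} \<subseteq> {0..<N}"
        using f(1) by (auto simp: PiE_iff)
      then have "bij_betw (\<lambda>i. if i < N then f i else i) {0..<N} {0..<N}"
        using inj endo_inj_surj[of "{0..<N}"] unfolding bij_betw_def by blast
      then have "(\<lambda>i. if i < N then f i else i) permutes {0..<N}"
        by (rule bij_imp_permutes) auto
      then show "(\<lambda>i. if i < N then f i else i) \<in> ?S" by simp
      show "\<forall>i<N. P i (if i < N then f i else i)" using f(3) by simp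
    qed
  qed
  finally show ?thesis .
qed

section \<open>Foata's transformation\<close>

text \<open>The relation between consecutive letters. On the diagonal it holds exactly for odd
  letters: words with distinct letters never meet this case, matchings do, as fixed points.\<close>

definition gr :: "nat \<Rightarrow> nat \<Rightarrow> bool" where
  "gr v w \<longleftrightarrow> (w < v \<longleftrightarrow> even v)"

text \<open>
  An open word is meant to be followed by a letter larger than all of its own, so its last letter
  must be odd.
\<close>

definition open_words :: "nat set \<Rightarrow> nat list set" where
  "open_words S = {u. distinct u \<and> set u = S \<and> successively gr u \<and> (u \<noteq> [] \<longrightarrow> odd (last u))}"

text \<open>Word form of a matching of \<open>insert p S\<close> with \<open>insert c S\<close>: the
  path from \<open>p\<close> to \<open>c\<close> is spelled by \<open>p # w\<close>, the permutation
  of the other letters by the open word \<open>u\<close>, and \<open>e\<close> tells which letters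
  may lead to \<open>c\<close>.\<close>

definition split_words :: "(nat \<Rightarrow> bool) \<Rightarrow> nat \<Rightarrow> nat set \<Rightarrow> (nat list \<times> nat list) set" where
  "split_words e p S = {(w, u). distinct (w @ u) \<and> set (w @ u) = S \<and> successively gr (p # w) \<and>
     e (last (p # w)) \<and> successively gr u \<and> (u \<noteq> [] \<longrightarrow> odd (last u))}"

lemma finite_split_words:
  assumes "finite S" shows "finite (split_words e p S)"
proof -
  have "split_words e p S \<subseteq> {xs. set xs \<subseteq> S \<and> distinct xs} \<times> {xs. set xs \<subseteq> S \<and> distinct xs}"
    by (auto simp: split_words_def)
  moreover have "finite {xs. set xs \<subseteq> S \<and> distinct xs}"
    using finite_subset_distinct[OF assms] by simp
  ultimately show ?thesis by (meson finite_SigmaI finite_subset)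
qed

lemma finite_open_words: "finite S \<Longrightarrow> finite (open_words S)"
  by (rule finite_subset[OF _ finite_subset_distinct[of S]]) (auto simp: open_words_def)

text \<open>Either the path stops at \<open>p\<close>, or its next letter \<open>x\<close> becomes
  the new start.\<close>

lemma card_split_words_rec:
  assumes "finite S"
  shows "card (split_words e p S) = (if e p then card (open_words S) else 0) +
    (\<Sum>x\<in>{x\<in>S. gr p x}. card (split_words e x (S - {x})))"
proof -
  define B where "B x = (\<lambda>(w, u). (x # w, u)) ` split_words e x (S - {x})" for x
  define A :: "(nat list \<times> nat list) set"
    where "A = (if e p then {[]} \<times> open_words S else {})"
  have eq: "split_words e p S = A \<union> (\<Union>x\<in>{x\<in>S. gr p x}. B x)"
  proof (intro equalityI subsetI)
    fix y assume y: "y \<in> split_words e p S"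
    obtain w u where wu: "y = (w, u)" by force
    show "y \<in> A \<union> (\<Union>x\<in>{x\<in>S. gr p x}. B x)"
    proof (cases w)
      case Nil
      then show ?thesis using y wu by (auto simp: A_def split_words_def open_words_def)
    next
      case (Cons x w')
      then have "x \<in> S" "gr p x" "(w', u) \<in> split_words e x (S - {x})"
        using y wu by (auto simp: split_words_def split: if_splits)
      then show ?thesis using Cons wu by (auto simp: B_def)
    qed
  next
    fix y assume "y \<in> A \<union> (\<Union>x\<in>{x\<in>S. gr p x}. B x)"
    then show "y \<in> split_words e p S"
      by (auto simp: A_def split_words_def open_words_def B_def split: if_splits)
  qed
  have cB: "card (B x) = card (split_words e x (S - {x}))" for x
    unfolding B_def by (rule card_image) (auto simp: inj_on_def)
  have fB: "finite (B x)" for x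
    using assms finite_split_words by (simp add: B_def)
  have "card (split_words e p S) = card A + card (\<Union>x\<in>{x\<in>S. gr p x}. B x)"
    unfolding eq
    by (rule card_Un_disjoint) (auto simp: A_def B_def assms finite_open_words finite_split_words)
  also have "card (\<Union>x\<in>{x\<in>S. gr p x}. B x) = (\<Sum>x\<in>{x\<in>S. gr p x}. card (B x))"
    using assms fB by (intro card_UN_disjoint) (auto simp: B_def)
  finally show ?thesis by (simp add: A_def cB card_cartesian_product)
qed

text \<open>
  The column \<open>c\<close> marks where the path through \<open>p # w\<close> ends. Expanding the matching along the row of
  the current letter \<open>p\<close> moves the path one step on: once \<open>p\<close> is mapped to \<open>x\<close>, the rows left are
  \<open>x\<close> and \<open>S - {x}\<close>, the columns left are \<open>c\<close> and \<open>S - {x}\<close>.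
\<close>

lemma card_split_words_eq_inj_count:
  assumes "finite S" "p \<notin> S" "c \<notin> S"
    and "\<And>T. T \<subseteq> S \<Longrightarrow> card (open_words T) = inj_count gr T T"
    and "\<And>v. v \<in> insert p S \<Longrightarrow> P v c = e v"
    and "\<And>v x. v \<in> insert p S \<Longrightarrow> x \<in> S \<Longrightarrow> P v x = gr v x"
  shows "card (split_words e p S) = inj_count P (insert p S) (insert c S)"
  using assms
proof (induction "card S" arbitrary: S p rule: less_induct)
  case less
  \<comment> \<open>The column \<open>c\<close> ends the path at \<open>p\<close> and leaves a
    matching of \<open>S\<close> with itself; any other column prolongs the path.\<close>
  have *: "{x \<in> insert c S. P p x} = (if e p then {c} else {}) \<union> {x\<in>S. gr p x}"
    using less.prems by auto
  have "inj_count P (insert p S) (insert c S) =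
      (\<Sum>x\<in>{x \<in> insert c S. P p x}. inj_count P S (insert c S - {x}))"
    using less.prems by (intro inj_count_insert) auto
  also have "\<dots> = (if e p then inj_count P S S else 0) +
      (\<Sum>x\<in>{x\<in>S. gr p x}. inj_count P S (insert c S - {x}))"
    unfolding * using less.prems by (subst sum.union_disjoint) auto
  also have "inj_count P S S = card (open_words S)"
    using less.prems inj_count_cong[of S S P gr] by auto
  also have "(\<Sum>x\<in>{x\<in>S. gr p x}. inj_count P S (insert c S - {x})) =
      (\<Sum>x\<in>{x\<in>S. gr p x}. card (split_words e x (S - {x})))"
  proof (rule sum.cong[OF refl])
    fix x assume x: "x \<in> {x\<in>S. gr p x}"
    have "card (split_words e x (S - {x})) = inj_count P (insert x (S - {x})) (insert c (S - {x}))"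
    proof (rule less.hyps)
      show "card (S - {x}) < card S" 
        using x by (intro card_Diff1_less less.prems) auto
      show "card (open_words T) = inj_count gr T T" if "T \<subseteq> S - {x}" for T
        using that by (intro less.prems) auto
    qed (use less.prems x in auto)
    moreover have "insert x (S - {x}) = S" "insert c (S - {x}) = insert c S - {x}"
      using x less.prems by auto
    ultimately show "inj_count P S (insert c S - {x}) = card (split_words e x (S - {x}))"
      by simp
  qed
  finally show ?case using card_split_words_rec[OF less.prems(1)] by simp
qed

text \<open>
  For a letter of \<open>S\<close>, being followed by the maximum \<open>M\<close> or by the end of an open word is the same
  condition, so cutting at \<open>M\<close> leaves an open word in front.
\<close>

lemma bij_betw_open_words:
  assumes S: "finite S" "M \<in> S" "\<And>x. x \<in> S \<Longrightarrow> x \<le> M"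
  shows "bij_betw (\<lambda>(w, u). u @ M # w) (split_words odd M (S - {M})) (open_words S)"
proof -
  have last_gr: "gr x M \<longleftrightarrow> odd x" if "x \<in> S" for x
    using S(3)[OF that] by (auto simp: gr_def)
  show ?thesis unfolding bij_betw_def
  proof (intro conjI equalityI subsetI)
    show "inj_on (\<lambda>(w, u). u @ M # w) (split_words odd M (S - {M}))"
    proof (rule inj_onI, clarify)
      fix w u w' u' assume "(w, u) \<in> split_words odd M (S - {M})"
        "(w', u') \<in> split_words odd M (S - {M})" and eq: "u @ M # w = u' @ M # w'"
      then have "M \<notin> set u" "M \<notin> set u'" "M \<notin> set w"
        by (auto simp: split_words_def)
      then have "u = u' \<and> w = w'" using eq by (metis append_Cons_eq_iff)
      then show "w = w' \<and> u = u'" by simp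
    qed
  next
    fix y assume "y \<in> (\<lambda>(w, u). u @ M # w) ` split_words odd M (S - {M})"
    then obtain w u where y: "y = u @ M # w" and wu: "(w, u) \<in> split_words odd M (S - {M})"
      by auto
    have "u \<noteq> [] \<Longrightarrow> last u \<in> S" using wu by (auto simp: split_words_def dest: last_in_set)
    then have "u \<noteq> [] \<Longrightarrow> gr (last u) M" using wu last_gr by (auto simp: split_words_def)
    then show "y \<in> open_words S"
      using wu S(2) y by (auto simp: split_words_def open_words_def successively_append_iff)
  next
    fix y assume y: "y \<in> open_words S"
    then have "M \<in> set y" using S by (simp add: open_words_def)
    then obtain u w where uw: "y = u @ M # w" by (meson split_list)
    have "u \<noteq> [] \<Longrightarrow> last u \<in> S"
      using y uw by (auto simp: open_words_def dest: last_in_set)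
    then have "u \<noteq> [] \<Longrightarrow> odd (last u)"
      using y uw last_gr by (auto simp: open_words_def successively_append_iff)
    then have "(w, u) \<in> split_words odd M (S - {M})"
      using y uw by (auto simp: open_words_def split_words_def successively_append_iff)
    then show "y \<in> (\<lambda>(w, u). u @ M # w) ` split_words odd M (S - {M})"
      using uw by force
  qed
qed

text \<open>With the maximum \<open>M\<close> as both start and end column, the path from
  \<open>M\<close> closes up to the cycle of \<open>M\<close>; the open word in front of
  \<open>M\<close> uses fewer letters.\<close>

lemma card_open_words:
  assumes "finite S" shows "card (open_words S) = inj_count gr S S"
  using assms
proof (induction "card S" arbitrary: S rule: less_induct)
  case less
  show ?case
  proof (cases "S = {}")
    case True
    then have "open_words S = {[]}" by (auto simp: open_words_def)
    then show ?thesis using True by simp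
  next
    case False
    define M where "M = Max S"
    have M: "M \<in> S" "\<And>x. x \<in> S \<Longrightarrow> x \<le> M" using False less.prems by (auto simp: M_def)
    have "card (open_words S) = card (split_words odd M (S - {M}))"
      using bij_betw_same_card[OF bij_betw_open_words[OF less.prems M]] by simp
    also have "\<dots> = inj_count gr (insert M (S - {M})) (insert M (S - {M}))"
    proof (rule card_split_words_eq_inj_count)
      fix T assume T: "T \<subseteq> S - {M}"
      then have "T \<subset> S" using M by auto
      then show "card (open_words T) = inj_count gr T T"
        using less by (meson finite_subset psubset_card_mono psubset_imp_subset)
    next
      \<comment> \<open>The case \<open>v = M\<close> is included: for odd \<open>M\<close>, the
        fixed point \<open>M\<close> corresponds to \<open>M\<close> being the last letter.\<close>
      fix v assume "v \<in> insert M (S - {M})"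
      then have "v \<le> M" using M by auto
      then show "gr v M = odd v" by (auto simp: gr_def)
    qed (use less.prems in auto)
    finally show ?thesis using M by (simp add: insert_absorb)
  qed
qed

section \<open>Kreweras numbers\<close>

text \<open>One-line notation. The last position carries no descent condition, and
  \<open>successively\<close> puts none on the last letter.\<close>

lemma Kreweras_eq_card_lists:
  "Kreweras m k = card {xs. distinct xs \<and> set xs = {1..2 * m + 1} \<and> successively gr xs \<and> hd xs = k + 1}"
proof -
  define I where "I = [1..<2 * m + 2]"
  define g where "g xs i = (if i \<in> {1..2 * m + 1} then xs ! (i - 1) else i)" for xs :: "nat list" and i
  have set_I: "set I = {1..2 * m + 1}" by (auto simp: I_def)
  have len_I: "length I = 2 * m + 1" by (simp add: I_def)
  have dist_I: "distinct I" by (simp add: I_def)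
  have len: "length xs = 2 * m + 1" if "distinct xs" "set xs = {1..2 * m + 1}" for xs :: "nat list"
    using distinct_card[OF that(1)] that(2) by simp
  have nth_I: "I ! i = i + 1" if "i < 2 * m + 1" for i
    using nth_upt[of 1 i "2 * m + 2"] that unfolding I_def by linarith
  have map_g: "map (g xs) I = xs" if "length xs = 2 * m + 1" for xs
    using that by (intro nth_equalityI) (auto simp: g_def nth_I len_I)
  have gr_iff: "successively gr (map \<sigma> I) \<longleftrightarrow> (\<forall>i\<in>{1..2 * m}. \<sigma> (i + 1) < \<sigma> i \<longleftrightarrow> even (\<sigma> i))" for \<sigma>
  proof -
    have "successively gr (map \<sigma> I) \<longleftrightarrow> (\<forall>i<2 * m. gr (\<sigma> (i + 1)) (\<sigma> (i + 2)))"
      by (simp add: successively_conv_nth nth_I len_I)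
    also have "\<dots> \<longleftrightarrow> (\<forall>i\<in>{1..2 * m}. gr (\<sigma> i) (\<sigma> (i + 1)))"
    proof safe
      fix i assume *: "\<forall>i<2 * m. gr (\<sigma> (i + 1)) (\<sigma> (i + 2))" and "i \<in> {1..2 * m}"
      then show "gr (\<sigma> i) (\<sigma> (i + 1))" using *[rule_format, of "i - 1"] by auto
    qed (force dest: bspec)
    finally show ?thesis by (simp add: gr_def)
  qed
  have hd_I: "hd (map \<sigma> I) = \<sigma> 1" for \<sigma> :: "nat \<Rightarrow> nat"
    by (simp add: I_def upt_conv_Cons del: upt_Suc)
  have "bij_betw (\<lambda>\<sigma>. map \<sigma> I) {\<sigma> \<in> Kreweras_perms m. \<sigma> 1 = k + 1}
     {xs. distinct xs \<and> set xs = {1..2 * m + 1} \<and> successively gr xs \<and> hd xs = k + 1}"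
  proof (rule bij_betw_byWitness[where f' = g], goal_cases)
    case 1
    have "g (map \<sigma> I) = \<sigma>" if "\<sigma> permutes {1..2 * m + 1}" for \<sigma>
      using that by (auto simp: g_def fun_eq_iff permutes_not_in nth_I len_I)
    then show ?case by (simp add: Kreweras_perms_def)
  next
    case 2
    show ?case using map_g len by blast
  next
    case 3
    show ?case
    proof (clarsimp simp: Kreweras_perms_def gr_iff hd_I)
      fix \<sigma> assume p: "\<sigma> permutes {Suc 0..Suc (2 * m)}"
      show "distinct (map \<sigma> I) \<and> \<sigma> ` set I = {Suc 0..Suc (2 * m)}"
        using permutes_inj_on[OF p] permutes_image[OF p] set_I
        by (simp add: distinct_map dist_I)
    qed
  next
    case 4
    show ?case
    proof (rule image_subsetI, safe)
      fix xs :: "nat list" assume xs: "distinct xs" "set xs = {1..2 * m + 1}" "successively gr xs" "hd xs = k + 1"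
      have m: "map (g xs) I = xs" using map_g len xs by blast
      have "g xs ` {1..2 * m + 1} = {1..2 * m + 1}"
        using arg_cong[OF m, of set] xs(2) set_I by (simp)
      moreover have "inj_on (g xs) {1..2 * m + 1}"
        using arg_cong[OF m, of distinct] xs(1) set_I by (simp add: distinct_map dist_I)
      ultimately have "g xs permutes {1..2 * m + 1}"
        by (intro bij_imp_permutes) (auto simp: bij_betw_def g_def)
      moreover have "\<forall>i\<in>{1..2 * m}. g xs (i + 1) < g xs i \<longleftrightarrow> even (g xs i)"
        using gr_iff[of "g xs"] xs(3) unfolding m by blast
      ultimately show "g xs \<in> Kreweras_perms m" by (simp add: Kreweras_perms_def)
      show "g xs 1 = k + 1" using hd_I[of "g xs"] xs(4) unfolding m by simp
    qed
  qed
  then show ?thesis by (simp add: Kreweras_def bij_betw_same_card)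
qed

text \<open>
  A word counted by the Kreweras number ends with \<open>2 * m + 1\<close>, since no letter can follow it, and the
  letter 2 can only be followed by 1, so the word is a path from \<open>k + 1\<close> to 2, then 1, an open word
  and \<open>2 * m + 1\<close>.
\<close>

lemma bij_betw_Kreweras_lists:
  assumes "1 \<le> m" "1 \<le> k" "k \<le> 2 * m - 1"
  shows "bij_betw (\<lambda>(w, u). (k + 1) # w @ 1 # u @ [2 * m + 1])
    (split_words (\<lambda>v. v = 2) (k + 1) ({2..2 * m} - {k + 1}))
    {xs. distinct xs \<and> set xs = {1..2 * m + 1} \<and> successively gr xs \<and> hd xs = k + 1}"
    (is "bij_betw ?f ?W ?L")
  unfolding bij_betw_def
proof (intro conjI equalityI subsetI)
  show "inj_on ?f ?W"
  proof (rule inj_onI)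
    fix x y assume x: "x \<in> ?W" and xy: "?f x = ?f y"
    obtain w u w' u' where [simp]: "x = (w, u)" "y = (w', u')" by (cases x, cases y)
    have wu: "(w, u) \<in> ?W" using x by simp
    have eq: "(k + 1) # w @ 1 # u @ [2 * m + 1] = (k + 1) # w' @ 1 # u' @ [2 * m + 1]"
      using xy by (simp only: split_conv \<open>x = (w, u)\<close> \<open>y = (w', u')\<close>)
    have "set w \<union> set u = {2..2 * m} - {k + 1}"
      using wu by (simp add: split_words_def)
    then have "set w \<subseteq> {2..2 * m}" "set u \<subseteq> {2..2 * m}" by blast+
    then have "1 \<notin> set w" "1 \<notin> set (u @ [2 * m + 1])"
      using assms(1) by auto
    moreover have "w @ 1 # (u @ [2 * m + 1]) = w' @ 1 # (u' @ [2 * m + 1])"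
      using eq by (simp only: list.inject)
    ultimately have "w = w' \<and> u @ [2 * m + 1] = u' @ [2 * m + 1]"
      using append_Cons_eq_iff[of 1 w "u @ [2 * m + 1]" w' "u' @ [2 * m + 1]"] by blast
    then show "x = y" by simp
  qed
next
  fix y assume "y \<in> ?f ` ?W"
  then obtain w u where y: "y = ((k + 1) # w) @ [1] @ u @ [2 * m + 1]" and wu: "(w, u) \<in> ?W"
    by auto
  have set_wu: "set w \<union> set u = {2..2 * m} - {k + 1}"
    and dist: "distinct (w @ u)" and succ: "successively gr ((k + 1) # w)" "successively gr u"
    and last: "last ((k + 1) # w) = 2" "u \<noteq> [] \<Longrightarrow> odd (last u)"
    using wu by (simp_all add: split_words_def)
  have w_le: "set w \<subseteq> {2..2 * m}" "k + 1 \<notin> set w" and u_le: "set u \<subseteq> {2..2 * m}" "k + 1 \<notin> set u"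
    using set_wu by blast+
  \<comment> \<open>The odd letter 1 may be followed by anything that is at least 1.\<close>
  have "hd (u @ [2 * m + 1]) \<in> set (u @ [2 * m + 1])" by (rule hd_in_set) simp
  then have "1 \<le> hd (u @ [2 * m + 1])" using u_le(1) by auto
  then have "gr 1 (hd (u @ [2 * m + 1]))" by (simp add: gr_def)
  moreover have "gr (last u) (2 * m + 1)" if "u \<noteq> []"
  proof -
    have "last u \<in> {2..2 * m}" using that last_in_set u_le(1) by blast
    then show ?thesis using last(2) that by (simp add: gr_def)
  qed
  ultimately have tail: "successively gr ([1] @ u @ [2 * m + 1])"
    using succ(2) by (cases "u = []") (simp_all add: successively_append_iff successively_Cons)
  have "successively gr (v @ [1] @ u @ [2 * m + 1])"
    if "successively gr v" "last v = 2" for v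
    using that tail unfolding successively_append_iff[of gr v] by (simp add: gr_def)
  from this[OF succ(1) last(1)] have "successively gr y" unfolding y .
  moreover have "distinct y"
    using dist w_le u_le assms unfolding y by auto
  moreover have "set y = {1..2 * m + 1}"
  proof -
    have "set y = insert (k + 1) (set w \<union> set u \<union> {1, 2 * m + 1})" unfolding y by auto
    also have "\<dots> = {1..2 * m + 1}" unfolding set_wu using assms by auto
    finally show ?thesis .
  qed
  ultimately show "y \<in> ?L" using y by simp
next
  fix y assume "y \<in> ?L"
  then have dist: "distinct y" and set_y: "set y = {1..2 * m + 1}"
    and succ: "successively gr y" and hd: "hd y = k + 1" by blast+
  have y_le: "1 \<le> x \<and> x \<le> 2 * m + 1" if "x \<in> set y" for x
    using that unfolding set_y by simp
  have step: "gr x b \<and> b \<in> set y" if "y = a @ x # b # c" for a x b c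
    using succ that by (simp add: successively_append_iff)
  have "2 * m + 1 \<in> set y" unfolding set_y by simp
  then obtain z z' where z: "y = z @ (2 * m + 1) # z'" by (meson split_list)
  \<comment> \<open>A successor of the odd letter \<open>2 * m + 1\<close> could not be smaller,
    hence would repeat it.\<close>
  have "z' = []"
  proof (cases z')
    case (Cons b c)
    then have "gr (2 * m + 1) b \<and> b \<in> set y" using step z by blast
    then have False using y_le[of b] dist z Cons by (auto simp: gr_def)
    then show ?thesis ..
  qed simp
  then have z': "y = z @ [2 * m + 1]" using z by simp
  have "1 \<in> set y" unfolding set_y by simp
  then have "1 \<in> set z" unfolding z' using assms by simp
  then obtain a u where a: "z = a @ 1 # u" by (meson split_list)
  have "2 \<in> set y" unfolding set_y using assms by simp
  then obtain c d where c: "y = c @ 2 # d" by (meson split_list)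
  \<comment> \<open>The word ends with an odd letter, so 2 has a successor, which must be 1.\<close>
  have "d \<noteq> []"
  proof
    assume "d = []"
    then have "last y = 2" using c by simp
    then show False using z' assms by simp
  qed
  then obtain x d' where d: "d = x # d'" by (cases d) auto
  then have "gr 2 x \<and> x \<in> set y" using step c by blast
  then have "x = 1" using y_le[of x] by (auto simp: gr_def)
  then have c': "y = (c @ [2]) @ 1 # d'" using c d by simp
  have a': "y = a @ 1 # (u @ [2 * m + 1])" using a z' by simp
  \<comment> \<open>Since 1 occurs only once, both ways of cutting at 1 agree, and the part before
    it ends with 2.\<close>
  have "1 \<notin> set (c @ [2])" "1 \<notin> set d'"
    using dist unfolding c' by auto
  then have ac: "a = c @ [2]"
    using append_Cons_eq_iff[of 1 "c @ [2]" d' a "u @ [2 * m + 1]"] a' c' by metis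
  then have "a \<noteq> []" by simp
  then obtain v w where w: "a = v # w" by (cases a) auto
  have v: "v = k + 1" using hd unfolding a' w by simp
  have yy: "y = (v # w) @ [1] @ u @ [2 * m + 1]" unfolding a' w by simp
  have "last (v # w) = 2" unfolding w[symmetric] ac by simp
  moreover have "set (w @ u) = {2..2 * m} - {k + 1}"
  proof -
    have "set y = insert v (insert 1 (insert (2 * m + 1) (set w \<union> set u)))"
      unfolding yy by auto
    moreover have "v \<notin> set w \<union> set u" "1 \<notin> set w \<union> set u" "2 * m + 1 \<notin> set w \<union> set u"
      using dist unfolding yy by auto
    ultimately have "set w \<union> set u = set y - {k + 1, 1, 2 * m + 1}"
      unfolding v by blast
    also have "\<dots> = {2..2 * m} - {k + 1}" unfolding set_y by auto
    finally show ?thesis by simp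
  qed
  \<comment> \<open>The last letter of \<open>u\<close> is followed by the larger letter
    \<open>2 * m + 1\<close>, so it is no descent top.\<close>
  moreover have "odd (last u)" if u: "u \<noteq> []"
  proof -
    have *: "y = ((v # w) @ [1] @ butlast u) @ last u # (2 * m + 1) # []"
      using u unfolding yy by simp
    then have "last u \<in> set y" by (metis in_set_conv_decomp)
    moreover have "last u \<noteq> 2 * m + 1" using dist unfolding * by simp
    ultimately show ?thesis using step[OF *] y_le[of "last u"] by (auto simp: gr_def)
  qed
  moreover have "successively gr (v # w)" "successively gr u"
    using succ unfolding yy successively_append_iff by blast+
  moreover have "distinct (w @ u)" using dist unfolding yy by auto
  ultimately have "(w, u) \<in> ?W"
    unfolding split_words_def v by blast
  moreover have "y = ?f (w, u)" unfolding yy v by simp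
  ultimately show "y \<in> ?f ` ?W" by blast
qed

text \<open>The end of the path becomes an extra column, open to row 2 only. Row 2 has no other
  choice, as no column in \<open>{2..2 * m}\<close> is below 2, so row and column cancel.\<close>

lemma Kreweras_eq_inj_count:
  assumes "1 \<le> m" "1 \<le> k" "k \<le> 2 * m - 1"
  shows "Kreweras m k = inj_count gr {3..2 * m} ({2..2 * m} - {k + 1})"
proof -
  \<comment> \<open>The number 0 lies outside \<open>S\<close> and serves as the end column.\<close>
  define P where "P v x = (if x = 0 then v = 2 else gr v x)" for v x
  define S where "S = {2..2 * m} - {k + 1}"
  have "Kreweras m k = card (split_words (\<lambda>v. v = 2) (k + 1) S)"
    using bij_betw_same_card[OF bij_betw_Kreweras_lists[OF assms]]
    by (simp add: Kreweras_eq_card_lists S_def)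
  also have "\<dots> = inj_count P (insert (k + 1) S) (insert 0 S)"
    by (rule card_split_words_eq_inj_count) (auto simp: S_def P_def card_open_words finite_subset)
  also have "insert (k + 1) S = insert 2 {3..2 * m}" using assms by (auto simp: S_def)
  also have "inj_count P (insert 2 {3..2 * m}) (insert 0 S) =
      (\<Sum>x\<in>{x \<in> insert 0 S. P 2 x}. inj_count P {3..2 * m} (insert 0 S - {x}))"
    by (rule inj_count_insert) (auto simp: S_def)
  also have "{x \<in> insert 0 S. P 2 x} = {0}" by (auto simp: S_def P_def gr_def)
  also have "(\<Sum>x\<in>{0}. inj_count P {3..2 * m} (insert 0 S - {x})) = inj_count P {3..2 * m} S"
    by (simp add: S_def)
  also have "\<dots> = inj_count gr {3..2 * m} S"
    by (rule inj_count_cong) (auto simp: P_def S_def)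
  finally show ?thesis by (simp add: S_def)
qed

section \<open>Genocchi and Bernoulli numbers\<close>

definition genocchi_functional :: "rat poly \<Rightarrow> rat" where
  "genocchi_functional p = (\<Sum>i\<le>degree p. coeff p i * genocchi i)"

text \<open>Padding with zero coefficients gives polynomials of different degree a common range of
  summation, from which linearity follows.\<close>

lemma genocchi_functional_bound:
  assumes "degree p \<le> n"
  shows "genocchi_functional p = (\<Sum>i\<le>n. coeff p i * genocchi i)"
  unfolding genocchi_functional_def using assms
  by (intro sum.mono_neutral_left) (auto simp: coeff_eq_0)

lemma genocchi_functional_add:
  "genocchi_functional (p + q) = genocchi_functional p + genocchi_functional q"
proof -
  let ?n = "max (degree p) (degree q)"
  show ?thesis
    using genocchi_functional_bound[of p ?n] genocchi_functional_bound[of q ?n]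
      genocchi_functional_bound[of "p + q" ?n]
    by (simp add: degree_add_le algebra_simps sum.distrib)
qed

lemma genocchi_functional_smult:
  "genocchi_functional (smult c p) = c * genocchi_functional p"
  by (cases "c = 0") (simp_all add: genocchi_functional_def sum_distrib_left mult.assoc)

lemma genocchi_functional_monom: "genocchi_functional (monom c n) = c * genocchi n"
proof -
  have "genocchi_functional (monom c n) = (\<Sum>i\<le>n. coeff (monom c n) i * genocchi i)"
    by (rule genocchi_functional_bound) (rule degree_monom_le)
  also have "\<dots> = (\<Sum>i\<in>{n}. coeff (monom c n) i * genocchi i)"
    by (rule sum.mono_neutral_right) auto
  finally show ?thesis by simp
qed

lemma genocchi_egf: "(2 * fps_X / (fps_exp 1 + 1)) * (fps_exp 1 + 1) = (2 * fps_X :: rat fps)"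
proof -
  have "fps_nth (fps_exp 1 + 1 :: rat fps) 0 \<noteq> 0" by simp
  then have "is_unit (fps_exp 1 + 1 :: rat fps)" by (simp add: fps_is_unit_iff)
  then show ?thesis by simp
qed

text \<open>Coefficients of \<open>x ^ n / n!\<close> in
  \<open>G(x) * (e^x + 1) = 2 * x\<close>.\<close>

lemma genocchi_binomial:
  "(\<Sum>k\<le>n. of_nat (n choose k) * genocchi k) + genocchi n = (if n = 1 then 2 else 0)"
proof -
  define f where "f = (2 * fps_X / (fps_exp 1 + 1) :: rat fps)"
  have "f * (fps_exp 1) + f = 2 * fps_X"
    using genocchi_egf by (simp add: f_def algebra_simps)
  then have "fps_nth (f * fps_exp 1 + f) n = fps_nth (2 * fps_X) n" by simp
  moreover have "fps_nth (2 * fps_X :: rat fps) n = (if n = 1 then 2 else 0)"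
    by (simp add: numeral_fps_const)
  ultimately have "(\<Sum>k\<le>n. fps_nth f k / fact (n - k)) + fps_nth f n = (if n = 1 then 2 else 0)"
    by (simp add: fps_mult_nth atLeast0AtMost)
  then have "fact n * ((\<Sum>k\<le>n. fps_nth f k / fact (n - k)) + fps_nth f n) = (if n = 1 then 2 else 0)"
    by simp
  moreover have "fact n * (\<Sum>k\<le>n. fps_nth f k / fact (n - k)) =
      (\<Sum>k\<le>n. of_nat (n choose k) * genocchi k)"
    unfolding sum_distrib_left
    by (intro sum.cong) (auto simp: genocchi_def f_def binomial_fact)
  ultimately show ?thesis
    by (simp add: genocchi_def f_def distrib_left)
qed

text \<open>On monomials this is \<open>genocchi_binomial\<close>; the rest is linearity.\<close>

lemma genocchi_functional_shift:
  "genocchi_functional (p \<circ>\<^sub>p [:1, 1:]) + genocchi_functional p = 2 * coeff p 1"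
proof -
  have mono: "genocchi_functional (monom 1 n \<circ>\<^sub>p [:1, 1:]) + genocchi_functional (monom 1 n) =
     2 * coeff (monom 1 n) 1" for n
  proof -
    have *: "monom 1 n \<circ>\<^sub>p [:1, 1:] = ([:1, 1:] ^ n :: rat poly)"
      by (induction n) (simp_all add: monom_Suc pcompose_pCons pcompose_1)
    have "degree ([:1, 1:] ^ n :: rat poly) \<le> n"
      using degree_power_le[of "[:1, 1:] :: rat poly" n] by simp
    then have "genocchi_functional ([:1, 1:] ^ n) = (\<Sum>i\<le>n. of_nat (n choose i) * genocchi i)"
      by (simp add: genocchi_functional_bound coeff_linear_poly_power)
    then show ?thesis using genocchi_binomial[of n] by (simp add: * genocchi_functional_monom)
  qed
  have "genocchi_functional (q \<circ>\<^sub>p [:1, 1:]) + genocchi_functional q = 2 * coeff q 1"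
    if "q = (\<Sum>i<k. smult (a i) (monom 1 i))" for q a and k :: nat
    using that
  proof (induction k arbitrary: q)
    case 0
    then show ?case by (simp add: genocchi_functional_def)
  next
    case (Suc k)
    then show ?case using mono[of k]
      by (simp add: pcompose_add pcompose_smult genocchi_functional_add genocchi_functional_smult
          algebra_simps flip: distrib_left)
  qed
  from this[where q = p and k = "Suc (degree p)" and a = "coeff p"] show ?thesis
    using poly_as_sum_of_monoms[of p] by (simp add: smult_monom lessThan_Suc_atMost)
qed

section \<open>Genocchi numbers in terms of Bernoulli numbers\<close>

lemma subdegree_fps_exp_minus_1: "subdegree (fps_exp 1 - 1 :: rat fps) = 1"
  by (rule subdegreeI) auto

lemma fps_exp_minus_1_nonzero: "(fps_exp 1 - 1 :: rat fps) \<noteq> 0"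
  using subdegree_fps_exp_minus_1 by auto

lemma bernoulli_egf: "fps_X / (fps_exp 1 - 1) * (fps_exp 1 - 1) = (fps_X :: rat fps)"
proof -
  have "(fps_exp 1 - 1 :: rat fps) dvd fps_X"
    using subdegree_fps_exp_minus_1 fps_exp_minus_1_nonzero by (auto simp: fps_dvd_iff)
  then show ?thesis by simp
qed

text \<open>With \<open>b(x) = x / (e^x - 1)\<close>, one has
  \<open>2 * x / (e^x + 1) = 2 * b(x) - 2 * b(2 * x)\<close>, because
  \<open>e^(2 * x) - 1 = (e^x - 1) * (e^x + 1)\<close>.\<close>

lemma genocchi_eq_bernoulli: "genocchi n = 2 * (1 - 2 ^ n) * bernoulli n"
proof -
  define b :: "rat fps" where "b = fps_X / (fps_exp 1 - 1)"
  have nz: "(fps_exp 1 - 1 :: rat fps) \<noteq> 0" and b: "b * (fps_exp 1 - 1) = fps_X"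
    unfolding b_def by (rule fps_exp_minus_1_nonzero bernoulli_egf)+
  let ?t = "fps_const 2 * fps_X :: rat fps"
  define c where "c = b oo ?t"
  have t0: "fps_nth ?t 0 = 0" by simp
  have c: "c * (fps_exp 2 - 1) = ?t"
  proof -
    have "(b * (fps_exp 1 - 1)) oo ?t = fps_X oo ?t" by (simp add: b)
    then show ?thesis using t0
      by (simp add: c_def fps_compose_mult_distrib fps_compose_sub_distrib fps_exp_compose_linear)
  qed
  have e2: "fps_exp 2 = (fps_exp 1 * fps_exp 1 :: rat fps)"
    by (simp flip: fps_exp_add_mult)
  have "(2 * b - 2 * c) * (fps_exp 1 + 1) * (fps_exp 1 - 1) =
     2 * (b * (fps_exp 1 - 1)) * (fps_exp 1 + 1) - 2 * (c * (fps_exp 2 - 1))"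
    by (simp add: e2 algebra_simps)
  also have "\<dots> = 2 * fps_X * (fps_exp 1 + 1) - 2 * ?t" by (simp only: b c)
  also have "\<dots> = 2 * fps_X * (fps_exp 1 - 1)"
    by (simp add: algebra_simps flip: numeral_fps_const)
  also have "\<dots> = (2 * fps_X / (fps_exp 1 + 1)) * (fps_exp 1 + 1) * (fps_exp 1 - 1)"
    by (simp only: genocchi_egf)
  finally have "(2 * b - 2 * c) * (fps_exp 1 + 1) = (2 * fps_X / (fps_exp 1 + 1)) * (fps_exp 1 + 1)"
    using nz by (simp only: mult_cancel_right) simp
  moreover have "fps_exp 1 + 1 \<noteq> (0 :: rat fps)"
  proof
    assume "fps_exp 1 + 1 = (0 :: rat fps)"
    then have "fps_nth (fps_exp 1 + 1 :: rat fps) 0 = fps_nth 0 0" by metis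
    then show False by simp
  qed
  ultimately have g: "2 * fps_X / (fps_exp 1 + 1) = 2 * b - 2 * c"
    by (simp only: mult_cancel_right) simp
  have "fps_nth c n = 2 ^ n * fps_nth b n"
    by (simp add: c_def fps_compose_linear)
  then have "fps_nth (2 * fps_X / (fps_exp 1 + 1)) n = 2 * (1 - 2 ^ n) * fps_nth b n"
    unfolding g by (simp add: numeral_fps_const algebra_simps)
  then show ?thesis
    unfolding genocchi_def bernoulli_def b_def[symmetric] by (simp only: mult_ac)
qed

text \<open>The series satisfies \<open>b(-x) = b(x) + x\<close>, so it is even up to its linear
  term.\<close>

lemma bernoulli_odd:
  assumes "odd n" "n \<noteq> 1"
  shows "bernoulli n = 0"
proof -
  define b :: "rat fps" where "b = fps_X / (fps_exp 1 - 1)"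
  have nz: "(fps_exp 1 - 1 :: rat fps) \<noteq> 0" and b: "b * (fps_exp 1 - 1) = fps_X"
    unfolding b_def by (rule fps_exp_minus_1_nonzero bernoulli_egf)+
  let ?t = "fps_const (-1) * fps_X :: rat fps"
  define c where "c = b oo ?t"
  have t0: "fps_nth ?t 0 = 0" by simp
  have c: "c * (fps_exp (-1) - 1) = ?t"
  proof -
    have "(b * (fps_exp 1 - 1)) oo ?t = fps_X oo ?t" by (simp add: b)
    then show ?thesis using t0
      by (simp add: c_def fps_compose_mult_distrib fps_compose_sub_distrib fps_exp_compose_linear)
  qed
  have e: "fps_exp (-1) * fps_exp 1 = (1 :: rat fps)"
    by (simp flip: fps_exp_add_mult)
  have "c * (1 - fps_exp 1) = c * (fps_exp (-1) - 1) * fps_exp 1"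
    using e by (simp add: algebra_simps)
  also have "\<dots> = - fps_X * fps_exp 1" unfolding c by (simp flip: fps_const_neg)
  finally have "c * (fps_exp 1 - 1) = (b + fps_X) * (fps_exp 1 - 1)"
    using b by (simp add: algebra_simps)
  then have "c = b + fps_X" using nz by simp
  then have "fps_nth c n = fps_nth b n" using assms by simp
  moreover have "fps_nth c n = - fps_nth b n"
    using assms by (simp add: c_def fps_compose_linear)
  ultimately show ?thesis by (simp add: bernoulli_def b_def)
qed

section \<open>Counting matchings by Genocchi numbers\<close>

text \<open>The number \<open>w m n\<close>. The \<open>n\<close> extra columns exceed every row, so
  they are open to exactly the odd rows.\<close>

definition dumont_count :: "nat \<Rightarrow> nat \<Rightarrow> nat" where
  "dumont_count m n = inj_count gr {1..2 * m} {1..2 * m + n}"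

text \<open>Rows up to \<open>2 * m\<close> cannot tell columns above \<open>2 * m\<close> apart, so
  only the number of these columns matters.\<close>

lemma inj_count_eq_dumont_count:
  assumes "finite E" "E \<subseteq> {2 * m<..}"
  shows "inj_count gr {1..2 * m} ({1..2 * m} \<union> E) = dumont_count m (card E)"
proof -
  obtain h where h: "bij_betw h E {2 * m + 1..2 * m + card E}"
    using finite_same_card_bij[of E "{2 * m + 1..2 * m + card E}"] assms(1) by auto
  define h' where "h' x = (if x \<le> 2 * m then x else h x)" for x
  have "bij_betw h' {1..2 * m} {1..2 * m}"
    by (rule bij_betw_cong[THEN iffD1, OF _ bij_betw_id]) (simp add: h'_def)
  moreover have "bij_betw h' E {2 * m + 1..2 * m + card E}"
    using h by (rule bij_betw_cong[THEN iffD1, rotated]) (use assms in \<open>auto simp: h'_def\<close>)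
  ultimately have "bij_betw h' ({1..2 * m} \<union> E) ({1..2 * m} \<union> {2 * m + 1..2 * m + card E})"
    by (rule bij_betw_combine) auto
  also have "{1..2 * m} \<union> {2 * m + 1..2 * m + card E} = {1..2 * m + card E}"
    by auto
  finally have "bij_betw h' ({1..2 * m} \<union> E) {1..2 * m + card E}" .
  moreover have "gr v x = gr v (h' x)" if "v \<in> {1..2 * m}" "x \<in> {1..2 * m} \<union> E" for v x
  proof (cases "x \<le> 2 * m")
    case False
    then have "h x \<in> {2 * m + 1..2 * m + card E}"
      using that h by (auto dest: bij_betwE)
    then show ?thesis using False that by (auto simp: h'_def gr_def)
  qed (simp add: h'_def)
  ultimately show ?thesis unfolding dumont_count_def
    by (intro inj_count_reindex[of id]) auto
qed

text \<open>Row \<open>2 * m + 1\<close> accepts precisely the columns in \<open>E\<close>, and each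
  choice leaves \<open>card E - 1\<close> of them. For empty \<open>E\<close> the factor
  \<open>card E\<close> makes the truncated subtraction harmless.\<close>

lemma inj_count_insert_odd:
  assumes "finite E" "E \<subseteq> {2 * m<..}"
  shows "inj_count gr (insert (2 * m + 1) {1..2 * m}) ({1..2 * m} \<union> E) =
    card E * dumont_count m (card E - 1)"
proof -
  have "{x \<in> {1..2 * m} \<union> E. gr (2 * m + 1) x} = E"
    using assms(2) by (auto simp: gr_def)
  then have "inj_count gr (insert (2 * m + 1) {1..2 * m}) ({1..2 * m} \<union> E) =
      (\<Sum>x\<in>E. inj_count gr {1..2 * m} ({1..2 * m} \<union> E - {x}))"
    using assms(1) by (subst inj_count_insert) auto
  also have "\<dots> = (\<Sum>x\<in>E. dumont_count m (card E - 1))"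
  proof (rule sum.cong[OF refl])
    fix x assume x: "x \<in> E"
    then have "{1..2 * m} \<union> E - {x} = {1..2 * m} \<union> (E - {x})" using assms(2) by auto
    then show "inj_count gr {1..2 * m} ({1..2 * m} \<union> E - {x}) = dumont_count m (card E - 1)"
      using x assms inj_count_eq_dumont_count[of "E - {x}" m] by auto
  qed
  finally show ?thesis by simp
qed

lemma dumont_count_0: "dumont_count 0 n = 1"
  by (simp add: dumont_count_def)

text \<open>
  The row \<open>2 * m + 2\<close> takes any free column except those to the right of \<open>2 * m + 1\<close>: count all free
  columns and subtract.
\<close>

lemma dumont_count_Suc:
  "dumont_count (Suc m) n + (n + 1) * (n + 1) * dumont_count m n =
    (n + 1) * (n + 2) * dumont_count m (n + 1)"
proof -
  define C where "C = {1..2 * m + 2 + n}"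
  define R where "R = insert (2 * m + 1) {1..2 * m}"
  have fin: "finite R" "finite C" and new: "2 * m + 2 \<notin> R" by (auto simp: R_def C_def)
  have C: "C = {1..2 * m} \<union> {2 * m + 1..2 * m + 2 + n}" by (auto simp: C_def)
  have "{1..2 * Suc m} = insert (2 * m + 2) R" by (auto simp: R_def)
  then have "dumont_count (Suc m) n = inj_count gr (insert (2 * m + 2) R) C"
    by (simp add: dumont_count_def C_def)
  also have "\<dots> = (\<Sum>x\<in>{x\<in>C. gr (2 * m + 2) x}. inj_count gr R (C - {x}))"
    using fin new by (rule inj_count_insert)
  finally have 1: "dumont_count (Suc m) n = (\<Sum>x\<in>{x\<in>C. gr (2 * m + 2) x}. inj_count gr R (C - {x}))" .
  \<comment> \<open>There are \<open>n + 1\<close> forbidden columns; removing any one leaves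
    \<open>n + 1\<close> columns above \<open>2 * m\<close>, to be used by row
    \<open>2 * m + 1\<close>.\<close>
  have "{x\<in>C. \<not> gr (2 * m + 2) x} = {2 * m + 2..2 * m + 2 + n}"
    by (auto simp: C_def gr_def)
  moreover have "inj_count gr R (C - {x}) = (n + 1) * dumont_count m n"
    if "x \<in> {2 * m + 2..2 * m + 2 + n}" for x
  proof -
    have "C - {x} = {1..2 * m} \<union> ({2 * m + 1..2 * m + 2 + n} - {x})"
      using that by (auto simp: C_def)
    moreover have "card ({2 * m + 1..2 * m + 2 + n} - {x}) = n + 1"
      using that by (subst card_Diff_singleton) auto
    moreover have "{2 * m + 1..2 * m + 2 + n} - {x} \<subseteq> {2 * m<..}"
      by auto
    ultimately show ?thesis
      using inj_count_insert_odd[of "{2 * m + 1..2 * m + 2 + n} - {x}" m] by (simp add: R_def)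
  qed
  ultimately have 2: "(\<Sum>x\<in>{x\<in>C. \<not> gr (2 * m + 2) x}. inj_count gr R (C - {x})) =
      (n + 1) * (n + 1) * dumont_count m n"
    by (simp add: algebra_simps)
  have "(\<Sum>x\<in>{x\<in>C. gr (2 * m + 2) x}. inj_count gr R (C - {x})) +
      (\<Sum>x\<in>{x\<in>C. \<not> gr (2 * m + 2) x}. inj_count gr R (C - {x})) =
      (\<Sum>x\<in>C. inj_count gr R (C - {x}))"
    using fin by (subst sum.union_disjoint[symmetric]) (auto intro!: sum.cong)
  also have "\<dots> = (card C - card R) * inj_count gr R C"
    using fin by (rule sum_inj_count_delete)
  also have "card C - card R = n + 1"
    by (simp add: R_def C_def)
  also have "inj_count gr R C = (n + 2) * dumont_count m (n + 1)"
    unfolding R_def C by (subst inj_count_insert_odd) auto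
  finally show ?thesis using 1 2 by (simp add: algebra_simps)
qed

section \<open>Evaluation of the counts by a truncated sine product\<close>

definition factor_poly :: "nat \<Rightarrow> rat poly" where
  "factor_poly n = (\<Prod>j = 1..n. [:1, 0, - 1 / (of_nat j)\<^sup>2:])"

lemma factor_poly_0 [simp]: "factor_poly 0 = 1"
  and factor_poly_Suc: "factor_poly (Suc n) = factor_poly n * [:1, 0, - 1 / (of_nat (Suc n))\<^sup>2:]"
  by (simp_all add: factor_poly_def)

text \<open>Up to a constant, \<open>s * poly (factor_poly n) s\<close> is the product of all
  \<open>s - j\<close> with \<open>-n \<le> j \<le> n\<close>. Shifting \<open>s\<close> by 1 trades
  the factor \<open>s - n\<close> for \<open>s + n + 1\<close>.\<close>

lemma poly_factor_shift:
  "(s - of_nat n) * ((s + 1) * poly (factor_poly n) (s + 1)) =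
   (s + of_nat n + 1) * (s * poly (factor_poly n) s)"
proof (induction n)
  case 0
  then show ?case by simp
next
  case (Suc n)
  define N where "N = (of_nat (Suc n) :: rat)"
  have N: "N \<noteq> 0" "of_nat n = N - 1" unfolding N_def by (auto simp del: of_nat_Suc simp: of_nat_Suc)
  define a where "a = (s + 1) * poly (factor_poly n) (s + 1)"
  define b where "b = s * poly (factor_poly n) s"
  have IH: "(s - N + 1) * a = (s + N) * b"
    using Suc unfolding N a_def b_def by (simp add: algebra_simps)
  have q: "poly [:1, 0, - 1 / N\<^sup>2:] x = (N - x) * (N + x) / N\<^sup>2" for x
    using N(1) by (simp add: field_simps power2_eq_square)
  have "(s - N) * ((s + 1) * poly (factor_poly (Suc n)) (s + 1)) =
      (s - N) * (a * ((N - (s + 1)) * (N + (s + 1)) / N\<^sup>2))"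
    unfolding factor_poly_Suc N_def[symmetric] poly_mult q by (simp add: a_def)
  also have "\<dots> = - (s - N) * (N + s + 1) * ((s - N + 1) * a) / N\<^sup>2"
    by (simp add: algebra_simps)
  also have "\<dots> = (s + N + 1) * (b * ((N - s) * (N + s) / N\<^sup>2))"
    unfolding IH by (simp add: algebra_simps)
  also have "\<dots> = (s + N + 1) * (s * poly (factor_poly (Suc n)) s)"
    unfolding factor_poly_Suc N_def[symmetric] poly_mult q by (simp add: b_def)
  finally show ?case by (simp only: N_def)
qed

text \<open>
  With \<open>N = n + 1\<close> and \<open>r s = s * \<Prod>j\<le>n. (1 - s\<^sup>2 / j\<^sup>2)\<close>, the polynomial \<open>c s = (s - N) * r s\<close> is a multiple of
  \<open>(s - N) \<cdots> (s + N - 1)\<close>, so \<open>c (s + 1) = (s + N) * r s\<close> and \<open>c (s + 1) + c s = 2 * s * r s\<close>.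
\<close>

lemma genocchi_functional_base:
  "genocchi_functional (- monom 1 2 * factor_poly n) = of_nat (n + 1)"
proof -
  define r where "r = pCons 0 (factor_poly n)"
  define c where "c = [:- of_nat (n + 1), 1:] * r"
  have "poly (c \<circ>\<^sub>p [:1, 1:] + c) s = poly (smult 2 (monom 1 2 * factor_poly n)) s" for s
  proof -
    have "poly (c \<circ>\<^sub>p [:1, 1:] + c) s =
        (s - of_nat n) * ((s + 1) * poly (factor_poly n) (s + 1)) +
        (s - of_nat n - 1) * (s * poly (factor_poly n) s)"
      by (simp add: c_def r_def poly_pcompose algebra_simps)
    also have "\<dots> = 2 * s\<^sup>2 * poly (factor_poly n) s"
      unfolding poly_factor_shift by (simp add: algebra_simps power2_eq_square)
    finally show ?thesis by (simp add: poly_monom)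
  qed
  then have eq: "c \<circ>\<^sub>p [:1, 1:] + c = smult 2 (monom 1 2 * factor_poly n)"
    by (intro poly_eq_poly_eq_iff[THEN iffD1]) auto
  \<comment> \<open>The shift formula sees only the linear coefficient of \<open>c\<close>, which is
    \<open>-(n + 1)\<close> times this constant term.\<close>
  have "coeff (factor_poly n) 0 = 1"
    by (induction n) (simp_all add: factor_poly_Suc coeff_mult)
  then have "coeff c 1 = - of_nat (n + 1)"
    by (simp add: c_def r_def)
  then have "2 * genocchi_functional (monom 1 2 * factor_poly n) = 2 * (- of_nat (n + 1))"
    using genocchi_functional_shift[of c] eq
    by (simp add: genocchi_functional_smult flip: genocchi_functional_add)
  then show ?thesis
    using genocchi_functional_smult[of "-1" "monom 1 2 * factor_poly n"] by simp
qed

lemma dumont_count_eq_genocchi_functional: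
  "of_nat ((n + 1) * dumont_count m n) =
    genocchi_functional ((- monom 1 2) ^ (m + 1) * factor_poly n)"
proof (induction m arbitrary: n)
  case 0
  show ?case using genocchi_functional_base[of n] by (simp add: dumont_count_0)
next
  case (Suc m)
  define N where "N = (of_nat (Suc n) :: rat)"
  define X :: "rat poly" where "X = - monom 1 2"
  define Q where "Q = X ^ (m + 1) * factor_poly n"
  have N: "N \<noteq> 0" by (simp add: N_def del: of_nat_Suc)
  \<comment> \<open>Splitting the last factor as \<open>1 + X / N^2\<close> expresses the value for
    \<open>m + 1\<close> at \<open>n\<close> by those for \<open>m\<close> at \<open>n + 1\<close>
    and \<open>n\<close>, matching \<open>dumont_count_Suc\<close>.\<close>
  have "[:1, 0, - 1 / N\<^sup>2:] = 1 + smult (1 / N\<^sup>2) X"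
    unfolding X_def by (rule poly_eqI) (simp add: coeff_pCons numeral_2_eq_2 split: nat.splits)
  then have "X ^ (m + 1) * factor_poly (Suc n) =
      Q + smult (1 / N\<^sup>2) (X ^ (Suc m + 1) * factor_poly n)"
    unfolding Q_def factor_poly_Suc N_def[symmetric] by (simp add: algebra_simps)
  then have "genocchi_functional (X ^ (m + 1) * factor_poly (Suc n)) =
      genocchi_functional Q +
      genocchi_functional (X ^ (Suc m + 1) * factor_poly n) / N\<^sup>2"
    by (simp add: genocchi_functional_add genocchi_functional_smult)
  then have "genocchi_functional (X ^ (Suc m + 1) * factor_poly n) =
      N\<^sup>2 * (of_nat ((Suc n + 1) * dumont_count m (Suc n)) - of_nat ((n + 1) * dumont_count m n))"
    using N unfolding X_def Suc Q_def by (simp add: field_simps)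
  moreover have "of_nat (dumont_count (Suc m) n + (n + 1) * (n + 1) * dumont_count m n) =
      (of_nat ((n + 1) * (n + 2) * dumont_count m (n + 1)) :: rat)"
    by (simp only: dumont_count_Suc)
  then have "of_nat (dumont_count (Suc m) n) =
      N * (of_nat ((Suc n + 1) * dumont_count m (Suc n)) - of_nat ((n + 1) * dumont_count m n))"
    by (simp add: N_def algebra_simps)
  moreover have "of_nat ((n + 1) * dumont_count (Suc m) n) = N * of_nat (dumont_count (Suc m) n)"
    by (simp add: N_def algebra_simps)
  ultimately show ?case
    unfolding X_def by (simp only: power2_eq_square mult.assoc)
qed

text \<open>At \<open>n = 0\<close> the product is empty and a single monomial remains.\<close>

lemma dumont_count_eq_genocchi:
  "of_nat (dumont_count m 0) = (-1) ^ (m + 1) * genocchi (2 * m + 2)"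
proof -
  have "(- monom 1 2 :: rat poly) ^ (m + 1) = monom ((-1) ^ (m + 1)) (2 * m + 2)"
    unfolding minus_monom monom_power by simp
  then show ?thesis
    using dumont_count_eq_genocchi_functional[of 0 m] by (simp add: genocchi_functional_monom)
qed

section \<open>The matrices\<close>

text \<open>Row 2 is forced into column 1. Among the columns left, row 1 consists of ones
  only.\<close>

lemma dumont_count_eq_inj_count:
  assumes "1 \<le> m"
  shows "dumont_count m 0 = inj_count gr (insert 1 {3..2 * m}) {2..2 * m}"
proof -
  have "{1..2 * m} = insert 2 (insert 1 {3..2 * m})" using assms by auto
  then have "dumont_count m 0 = inj_count gr (insert 2 (insert 1 {3..2 * m})) {1..2 * m}"
    by (simp add: dumont_count_def)
  also have "\<dots> = (\<Sum>x\<in>{x \<in> {1..2 * m}. gr 2 x}. inj_count gr (insert 1 {3..2 * m}) ({1..2 * m} - {x}))"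
    by (rule inj_count_insert) auto
  also have "{x \<in> {1..2 * m}. gr 2 x} = {1}" using assms by (auto simp: gr_def)
  also have "(\<Sum>x\<in>{1}. inj_count gr (insert 1 {3..2 * m}) ({1..2 * m} - {x})) =
      inj_count gr (insert 1 {3..2 * m}) ({1..2 * m} - {1})"
    by simp
  also have "{1..2 * m} - {1} = {2..2 * m}" by auto
  finally show ?thesis .
qed

lemma dumont_count_eq_sum:
  assumes "1 \<le> m"
  shows "dumont_count m 0 = (\<Sum>x\<in>{2..2 * m}. inj_count gr {3..2 * m} ({2..2 * m} - {x}))"
proof -
  have "{x \<in> {2..2 * m}. gr 1 x} = {2..2 * m}" by (auto simp: gr_def)
  then show ?thesis
    using dumont_count_eq_inj_count[OF assms] inj_count_insert[of "{3..2 * m}" "{2..2 * m}" 1 gr] by simp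
qed

text \<open>Rows 2 and, for \<open>m > 0\<close>, \<open>2 * m + 1\<close> are forced into columns 1
  and \<open>2 * m + 1\<close>. Then row \<open>2 * m + 2\<close> has only ones and takes the place
  of row 1.\<close>

lemma inj_count_shifted_eq_dumont_count:
  "inj_count gr {2..2 * m + 2} {1..2 * m + 1} = dumont_count m 0"
proof -
  have "{2..2 * m + 2} = insert 2 {3..2 * m + 2}" by auto
  then have "inj_count gr {2..2 * m + 2} {1..2 * m + 1} =
      (\<Sum>x\<in>{x \<in> {1..2 * m + 1}. gr 2 x}. inj_count gr {3..2 * m + 2} ({1..2 * m + 1} - {x}))"
    by (simp only:) (rule inj_count_insert, auto)
  also have "{x \<in> {1..2 * m + 1}. gr 2 x} = {1}" by (auto simp: gr_def)
  also have "(\<Sum>x\<in>{1}. inj_count gr {3..2 * m + 2} ({1..2 * m + 1} - {x})) =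
      inj_count gr {3..2 * m + 2} {2..2 * m + 1}"
    by simp (rule arg_cong[of _ _ "inj_count _ _"], auto)
  also have "\<dots> = dumont_count m 0"
  proof (cases "m = 0")
    case True
    then show ?thesis by (simp add: dumont_count_0)
  next
    case False
    then have "{3..2 * m + 2} = insert (2 * m + 1) (insert (2 * m + 2) {3..2 * m})" by auto
    then have "inj_count gr {3..2 * m + 2} {2..2 * m + 1} = (\<Sum>x\<in>{x \<in> {2..2 * m + 1}. gr (2 * m + 1) x}.
        inj_count gr (insert (2 * m + 2) {3..2 * m}) ({2..2 * m + 1} - {x}))"
      by (simp only:) (rule inj_count_insert, auto)
    also have "{x \<in> {2..2 * m + 1}. gr (2 * m + 1) x} = {2 * m + 1}"
      using False by (auto simp: gr_def)
    also have "(\<Sum>x\<in>{2 * m + 1}. inj_count gr (insert (2 * m + 2) {3..2 * m}) ({2..2 * m + 1} - {x})) =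
        inj_count gr (insert (2 * m + 2) {3..2 * m}) {2..2 * m}"
      by simp (rule arg_cong[of _ _ "inj_count _ _"], auto)
    also have "\<dots> = (\<Sum>x\<in>{x \<in> {2..2 * m}. gr (2 * m + 2) x}. inj_count gr {3..2 * m} ({2..2 * m} - {x}))"
      by (rule inj_count_insert) auto
    also have "{x \<in> {2..2 * m}. gr (2 * m + 2) x} = {2..2 * m}" by (auto simp: gr_def)
    finally show ?thesis using False by (simp add: dumont_count_eq_sum)
  qed
  finally show ?thesis .
qed

text \<open>The letter of the 0-based row \<open>i\<close>: first 3, 5, ...,
  \<open>2 * m - 1\<close>, then 4, 6, ..., \<open>2 * m\<close>, and 1 for the row of ones. Column
  \<open>j\<close> has the letter \<open>j + 2\<close>.\<close>

definition Lt_row :: "nat \<Rightarrow> nat \<Rightarrow> nat" where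
  "Lt_row m i = (if i < m - 1 then 2 * i + 3 else if i < 2 * m - 2 then 2 * (i + 1 - m) + 4 else 1)"

lemma Lt_mat_index:
  assumes "i < 2 * m - 1" "j < 2 * m - 1"
  shows "Lt_mat m $$ (i, j) = of_bool (gr (Lt_row m i) (j + 2))"
proof -
  have "Lt_mat m $$ (i, j) = Lt_entry m (i + 1) (j + 1)"
    using assms by (simp add: Lt_mat_def mat_of_entries_def)
  also have "\<dots> = of_bool (gr (Lt_row m i) (j + 2))"
    using assms by (auto simp: Lt_entry_def gr_def Lt_row_def)
  finally show ?thesis .
qed

lemma bij_betw_Lt_row: "bij_betw (Lt_row m) {0..<2 * m - 2} {3..2 * m}"
proof -
  have inj: "inj_on (Lt_row m) {0..<2 * m - 2}"
  proof (rule inj_onI)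
    fix x y assume "x \<in> {0..<2 * m - 2}" "y \<in> {0..<2 * m - 2}" "Lt_row m x = Lt_row m y"
    then show "x = y" unfolding Lt_row_def by (simp split: if_splits) presburger+
  qed
  have "Lt_row m ` {0..<2 * m - 2} \<subseteq> {3..2 * m}" by (auto simp: Lt_row_def)
  moreover have "card (Lt_row m ` {0..<2 * m - 2}) = card {3..2 * m}"
    using inj by (simp add: card_image)
  ultimately have "Lt_row m ` {0..<2 * m - 2} = {3..2 * m}"
    by (intro card_subset_eq) auto
  then show ?thesis using inj by (simp add: bij_betw_def)
qed

text \<open>The deleted row carries the letter 1 and the deleted column the letter
  \<open>k + 1\<close>.\<close>

lemma Lt_minor_eq_inj_count:
  assumes "1 \<le> m" "1 \<le> k" "k \<le> 2 * m - 1"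
  shows "Lt_minor m k = int (inj_count gr {3..2 * m} ({2..2 * m} - {k + 1}))"
proof -
  define A where "A = mat_delete (Lt_mat m) (2 * m - 2) (k - 1)"
  \<comment> \<open>Columns from the deleted one on move up by one, so \<open>h\<close> skips
    \<open>k + 1\<close>.\<close>
  define h where "h j = (if j < k - 1 then j else Suc j) + 2" for j
  have dim: "Lt_mat m \<in> carrier_mat (2 * m - 1) (2 * m - 1)"
    by (simp add: Lt_mat_def mat_of_entries_def)
  then have A: "A \<in> carrier_mat (2 * m - 2) (2 * m - 2)"
    by (auto simp: A_def mat_delete_def numeral_2_eq_2)
  have entry: "A $$ (i, j) = 1 * of_bool (gr (Lt_row m i) (h j))" if "i < 2 * m - 2" "j < 2 * m - 2" for i j
  proof -
    have "A $$ (i, j) = Lt_mat m $$ (i, if j < k - 1 then j else Suc j)"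
      using that dim by (auto simp: A_def mat_delete_def)
    also have "\<dots> = of_bool (gr (Lt_row m i) (h j))"
      using that by (subst Lt_mat_index) (auto simp: h_def)
    finally show ?thesis by simp
  qed
  have "inj_on h {0..<2 * m - 2}"
    by (auto simp: inj_on_def h_def split: if_splits)
  moreover have "h ` {0..<2 * m - 2} = {2..2 * m} - {k + 1}"
  proof (rule card_subset_eq)
    show "h ` {0..<2 * m - 2} \<subseteq> {2..2 * m} - {k + 1}"
      using assms by (auto simp: h_def split: if_splits)
    show "card (h ` {0..<2 * m - 2}) = card ({2..2 * m} - {k + 1})"
      using assms calculation by (subst card_Diff_singleton) (auto simp: card_image)
  qed simp
  ultimately have h: "bij_betw h {0..<2 * m - 2} ({2..2 * m} - {k + 1})"
    by (simp add: bij_betw_def)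
  have "Lt_minor m k = int (inj_count (\<lambda>i j. gr (Lt_row m i) (h j)) {0..<2 * m - 2} {0..<2 * m - 2})"
    using permanent_eq_inj_count[OF A entry] by (simp add: Lt_minor_def A_def)
  also have "inj_count (\<lambda>i j. gr (Lt_row m i) (h j)) {0..<2 * m - 2} {0..<2 * m - 2} =
      inj_count gr {3..2 * m} ({2..2 * m} - {k + 1})"
    by (rule inj_count_reindex[OF bij_betw_Lt_row h]) simp
  finally show ?thesis .
qed

lemma bij_betw_shift: "bij_betw (\<lambda>j. j + c) {0..<n} {c..<n + c :: nat}"
  by (rule bij_betw_byWitness[where f' = "\<lambda>j. j - c"]) auto

lemma permanent_Lt_mat:
  assumes "1 \<le> m"
  shows "permanent (Lt_mat m) = int (dumont_count m 0)"
proof -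
  have dim: "Lt_mat m \<in> carrier_mat (2 * m - 1) (2 * m - 1)"
    by (simp add: Lt_mat_def mat_of_entries_def)
  have row: "bij_betw (Lt_row m) {0..<2 * m - 1} (insert 1 {3..2 * m})"
  proof -
    have "bij_betw (Lt_row m) ({0..<2 * m - 2} \<union> {2 * m - 2}) ({3..2 * m} \<union> {Lt_row m (2 * m - 2)})"
      by (rule notIn_Un_bij_betw[OF _ _ bij_betw_Lt_row]) (auto simp: Lt_row_def)
    moreover have "{0..<2 * m - 2} \<union> {2 * m - 2} = {0..<2 * m - 1}" using assms by auto
    moreover have "Lt_row m (2 * m - 2) = 1" by (auto simp: Lt_row_def)
    ultimately show ?thesis by simp
  qed
  have "{2..<2 * m - 1 + 2} = {2..2 * m}" using assms by auto
  then have col: "bij_betw (\<lambda>j. j + 2) {0..<2 * m - 1} {2..2 * m}"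
    using bij_betw_shift[of 2 "2 * m - 1"] by simp
  have "permanent (Lt_mat m) =
      int (inj_count (\<lambda>i j. gr (Lt_row m i) (j + 2)) {0..<2 * m - 1} {0..<2 * m - 1})"
    using permanent_eq_inj_count[OF dim, of "\<lambda>_. 1"] Lt_mat_index by simp
  also have "inj_count (\<lambda>i j. gr (Lt_row m i) (j + 2)) {0..<2 * m - 1} {0..<2 * m - 1} =
      inj_count gr (insert 1 {3..2 * m}) {2..2 * m}"
    by (rule inj_count_reindex[OF row col]) simp
  finally show ?thesis using assms by (simp add: dumont_count_eq_inj_count)
qed

section \<open>The floor matrix\<close>

definition floor_row :: "nat \<Rightarrow> nat \<Rightarrow> nat" where
  "floor_row m i = (if i < m then 2 * i + 3 else 2 * (i + 1 - m))"

lemma bij_betw_floor_row: "bij_betw (floor_row m) {0..<2 * m + 1} {2..2 * m + 2}"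
proof -
  have inj: "inj_on (floor_row m) {0..<2 * m + 1}"
  proof (rule inj_onI)
    fix x y assume "x \<in> {0..<2 * m + 1}" "y \<in> {0..<2 * m + 1}" "floor_row m x = floor_row m y"
    then show "x = y" unfolding floor_row_def by (simp split: if_splits) presburger+
  qed
  have "floor_row m ` {0..<2 * m + 1} \<subseteq> {2..2 * m + 2}" by (auto simp: floor_row_def)
  moreover have "card (floor_row m ` {0..<2 * m + 1}) = card {2..2 * m + 2}"
    using inj by (simp add: card_image)
  ultimately have "floor_row m ` {0..<2 * m + 1} = {2..2 * m + 2}"
    by (intro card_subset_eq) auto
  then show ?thesis using inj by (simp add: bij_betw_def)
qed

text \<open>The quotient lies strictly between -1 and 1 for the first \<open>m\<close> rows, and in
  \<open>[0, 2)\<close> for the others. So the nonzero entries are -1 above and 1 below, and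
  \<open>floor_row\<close> lists the odd letters from 3, then the even ones.\<close>

lemma floor_entry:
  assumes "i < 2 * m + 1" "j < 2 * m + 1"
  shows "\<lfloor>(2 * real (i + 1) - real (j + 1)) / real (2 * m + 1)\<rfloor> =
    (if i < m then - 1 else 1) * of_bool (gr (floor_row m i) (j + 1))"
proof (cases "i < m")
  case True
  have "gr (floor_row m i) (j + 1) \<longleftrightarrow> 2 * (i + 1) < j + 1"
    using True by (auto simp: gr_def floor_row_def)
  moreover have "\<lfloor>(2 * real (i + 1) - real (j + 1)) / real (2 * m + 1)\<rfloor> =
      (if 2 * (i + 1) < j + 1 then - 1 else 0)"
  proof (rule floor_unique)
    show "of_int (if 2 * (i + 1) < j + 1 then - 1 else 0) \<le>
        (2 * real (i + 1) - real (j + 1)) / real (2 * m + 1)"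
      using True assms by (auto simp: field_simps)
    show "(2 * real (i + 1) - real (j + 1)) / real (2 * m + 1) <
        of_int (if 2 * (i + 1) < j + 1 then - 1 else 0) + 1"
      using True assms by (auto simp: field_simps)
  qed
  ultimately show ?thesis using True by simp
next
  case False
  have "gr (floor_row m i) (j + 1) \<longleftrightarrow> j + 1 < 2 * (i + 1 - m)"
    using False by (auto simp: gr_def floor_row_def)
  moreover have "\<lfloor>(2 * real (i + 1) - real (j + 1)) / real (2 * m + 1)\<rfloor> =
      (if j + 1 < 2 * (i + 1 - m) then 1 else 0)"
  proof (rule floor_unique)
    have r: "real (i + 1 - m) = real i + 1 - real m" using False by (simp add: of_nat_diff)
    have ij: "real i \<le> 2 * real m" "real j \<le> 2 * real m" "real m \<le> real i" using assms False by auto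
    \<comment> \<open>Integrality sharpens the strict inequality by 1, which the comparison with the
      odd denominator needs.\<close>
    have *: "j + 1 < 2 * (i + 1 - m) \<longleftrightarrow> real j + 2 \<le> 2 * (real i + 1 - real m)"
      unfolding r[symmetric] by linarith
    have **: "\<not> j + 1 < 2 * (i + 1 - m) \<longleftrightarrow> real j + 1 \<ge> 2 * (real i + 1 - real m)"
      unfolding r[symmetric] by linarith
    show "of_int (if j + 1 < 2 * (i + 1 - m) then 1 else 0) \<le>
        (2 * real (i + 1) - real (j + 1)) / real (2 * m + 1)"
      using ij * by (auto simp: field_simps)
    show "(2 * real (i + 1) - real (j + 1)) / real (2 * m + 1) <
        of_int (if j + 1 < 2 * (i + 1 - m) then 1 else 0) + 1"
      using ij ** by (auto simp: field_simps)
  qed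
  ultimately show ?thesis using False by simp
qed

text \<open>The \<open>m\<close> rows with negative entries give the sign.\<close>

lemma permanent_floor_odd:
  "permanent (mat_of_entries (2 * m + 1) (\<lambda>j k. \<lfloor>(2 * real j - real k) / real (2 * m + 1)\<rfloor>)) =
    (- 1) ^ m * int (dumont_count m 0)"
proof -
  let ?N = "2 * m + 1"
  define A where "A = mat_of_entries ?N (\<lambda>j k. \<lfloor>(2 * real j - real k) / real ?N\<rfloor>)"
  have A: "A \<in> carrier_mat ?N ?N" by (simp add: A_def mat_of_entries_def)
  have entry: "A $$ (i, j) = (if i < m then - 1 else 1) * of_bool (gr (floor_row m i) (j + 1))"
    if "i < ?N" "j < ?N" for i j
    unfolding floor_entry[OF that, symmetric] using that by (simp add: A_def mat_of_entries_def)
  have col: "bij_betw (\<lambda>j. j + 1) {0..<?N} {1..?N}"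
    using bij_betw_shift[of 1 ?N] by (simp add: atLeastLessThanSuc_atLeastAtMost)
  have "(\<Prod>i<?N. if i < m then - 1 else 1 :: int) = (\<Prod>i<m. - 1)"
    by (rule prod.mono_neutral_cong_right) auto
  then have "permanent A = (- 1) ^ m * int (inj_count (\<lambda>i j. gr (floor_row m i) (j + 1)) {0..<?N} {0..<?N})"
    using permanent_eq_inj_count[OF A entry] by simp
  also have "inj_count (\<lambda>i j. gr (floor_row m i) (j + 1)) {0..<?N} {0..<?N} =
      inj_count gr {2..2 * m + 2} {1..?N}"
    by (rule inj_count_reindex[OF bij_betw_floor_row col]) simp
  finally show ?thesis by (simp only: A_def inj_count_shifted_eq_dumont_count)
qed

text \<open>The middle row vanishes: for \<open>j = m\<close> the quotient is
  \<open>(2 * m - k) / (2 * m)\<close>, which lies in \<open>[0, 1)\<close>.\<close>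

lemma permanent_floor_even:
  assumes "1 \<le> m"
  shows "permanent (mat_of_entries (2 * m) (\<lambda>j k. \<lfloor>(2 * real j - real k) / real (2 * m)\<rfloor>)) = 0"
proof -
  define A where "A = mat_of_entries (2 * m) (\<lambda>j k. \<lfloor>(2 * real j - real k) / real (2 * m)\<rfloor>)"
  have dim: "dim_row A = 2 * m" by (simp add: A_def mat_of_entries_def)
  have zero: "A $$ (m - 1, j) = 0" if "j < 2 * m" for j
  proof -
    have "A $$ (m - 1, j) = \<lfloor>(2 * real m - real (j + 1)) / real (2 * m)\<rfloor>"
      using that assms by (simp add: A_def mat_of_entries_def algebra_simps)
    also have "\<dots> = 0"
      using that assms by (intro floor_unique) (auto simp: field_simps)
    finally show ?thesis .
  qed
  have "permanent A = 0"
    unfolding permanent_def dim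
  proof (intro sum.neutral ballI prod_zero)
    fix \<pi> assume "\<pi> \<in> {\<pi>. \<pi> permutes {0..<2 * m}}"
    then have "\<pi> (m - 1) < 2 * m"
      using assms permutes_in_image[of \<pi> "{0..<2 * m}" "m - 1"] by auto
    then show "\<exists>i\<in>{0..<2 * m}. A $$ (i, \<pi> i) = 0"
      using assms by (intro bexI[of _ "m - 1"] zero) auto
  qed simp
  then show ?thesis by (simp only: A_def)
qed

theorem theorem2p3:
  shows "(\<forall>m k :: nat. 1 \<le> m \<and> 1 \<le> k \<and> k \<le> 2 * m - 1 \<longrightarrow>
            Lt_minor m k = int (Kreweras m k))
       \<and> (\<forall>m :: nat. 1 \<le> m \<longrightarrow>
            of_int (permanent (Lt_mat m)) = (-1) ^ (m + 1) * genocchi (2 * m + 2))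
       \<and> (\<forall>n :: nat. 1 \<le> n \<longrightarrow>
            of_int (permanent (mat_of_entries n (\<lambda>j k. \<lfloor>(2 * real j - real k) / real n\<rfloor>)))
              = 2 * (2 ^ (n + 1) - 1) * bernoulli (n + 1))"
proof (intro conjI allI impI)
  fix m k :: nat assume "1 \<le> m \<and> 1 \<le> k \<and> k \<le> 2 * m - 1"
  then show "Lt_minor m k = int (Kreweras m k)"
    by (simp only: Lt_minor_eq_inj_count Kreweras_eq_inj_count)
next
  fix m :: nat assume "1 \<le> m"
  then show "of_int (permanent (Lt_mat m)) = (-1) ^ (m + 1) * genocchi (2 * m + 2)"
    by (simp only: permanent_Lt_mat of_int_of_nat_eq dumont_count_eq_genocchi)
next
  fix n :: nat assume n: "1 \<le> n"
  show "of_int (permanent (mat_of_entries n (\<lambda>j k. \<lfloor>(2 * real j - real k) / real n\<rfloor>)))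
      = 2 * (2 ^ (n + 1) - 1) * bernoulli (n + 1)"
  proof (cases "even n")
    case True
    then obtain m where m: "n = 2 * m" by (elim evenE)
    \<comment> \<open>Here \<open>n + 1\<close> is odd and at least 3, so both sides vanish.\<close>
    have "bernoulli (n + 1) = 0" using True n by (intro bernoulli_odd) auto
    then show ?thesis using permanent_floor_even[of m] n unfolding m by simp
  next
    case False
    then obtain m where m: "n = 2 * m + 1" by (elim oddE)
    have "of_int (permanent (mat_of_entries n (\<lambda>j k. \<lfloor>(2 * real j - real k) / real n\<rfloor>))) =
        (- 1) ^ m * (of_nat (dumont_count m 0) :: rat)"
      unfolding m permanent_floor_odd by simp
    \<comment> \<open>The signs \<open>(-1)^m\<close> and \<open>(-1)^(m + 1)\<close> combine to -1,
      and \<open>2 * m + 2 = n + 1\<close>.\<close>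
    also have "\<dots> = - genocchi (n + 1)"
      unfolding dumont_count_eq_genocchi m by (simp flip: power_mult_distrib)
    finally show ?thesis by (simp add: genocchi_eq_bernoulli algebra_simps)
  qed
qed

end
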